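(* Let $V=\{1,\dots,N\}$ be a finite set, let $u_t: V\to\mathbb{R}$ satisfy $u_t(i)\ge 0$ for all $i\in V$, let $s_t: V\times V\to\mathbb{R}$ satisfy $s_t(i,j)\ge 0$ for all $i,j\in V$, and let $\lambda_t\ge 0$ be a real number. Then the set function $G_t: 2^V\to\mathbb{R}$ defined by $$G_t(S)=\sum_{i\in S}u_t(i)+\lambda_t\sum_{j\in V}\max_{i\in S}s_t(i,j)$$ is monotone and submodular.
   Context: The maximum over the empty set is taken to be $0$, so $G_t(\emptyset)=0$. A set function $G:2^V\to\mathbb{R}$ is monotone if $G(A)\le G(B)$ whenever $A\subseteq B\subseteq V$, and submodular if $G(A\cup\{e\})-G(A)\ge G(B\cup\{e\})-G(B)$ whenever $A\subseteq B\subseteq V$ and $e\in V\setminus B$. The subscript $t$ is a fixed round index and plays no role. *)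

theory Defs
  imports Complex_Main
begin

(* Only used on finite S: Max is unspecified on infinite sets. *)
definition max_or_zero :: "('a \<Rightarrow> real) \<Rightarrow> 'a set \<Rightarrow> real" where
  "max_or_zero f S = (if S = {} then 0 else Max (f ` S))"

(* Set functions on 2^V are total functions on sets, of which only the values on
   subsets of V matter; monotonicity of G is the library's mono_on (Pow V) G. *)
definition submodular_on :: "'a set \<Rightarrow> ('a set \<Rightarrow> real) \<Rightarrow> bool" where
  "submodular_on V G \<longleftrightarrow>
     (\<forall>A B e. A \<subseteq> B \<and> B \<subseteq> V \<and> e \<in> V - B \<longrightarrow>
        G (A \<union> {e}) - G A \<ge> G (B \<union> {e}) - G B)"

definition gain ::
    "'a set \<Rightarrow> ('a \<Rightarrow> real) \<Rightarrow> ('a \<Rightarrow> 'a \<Rightarrow> real) \<Rightarrow> real \<Rightarrow> 'a set \<Rightarrow> real" where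
  "gain V u s l S = (\<Sum>i\<in>S. u i) + l * (\<Sum>j\<in>V. max_or_zero (\<lambda>i. s i j) S)"

end

(* On nonnegative functions max_or_zero satisfies m (insert e S) = max (f e) (m S), so its marginal
   gain max 0 (f e - m S) is antitone in m S, and m itself is monotone. Monotonicity and diminishing
   returns then pass to the nonnegative combination with a modular term. *)

theory Submission
  imports Defs
begin

text \<open>For empty \<open>S\<close> the default 0 is absorbed because \<open>f e\<close> is
  nonnegative; for nonempty \<open>S\<close> this is the usual recursion for
  \<open>Max\<close>.\<close>

lemma max_or_zero_insert:
  assumes "finite S" "f e \<ge> 0"
  shows "max_or_zero f (insert e S) = max (f e) (max_or_zero f S)"
  using assms by (auto simp: max_or_zero_def)

lemma max_or_zero_mono:
  assumes "finite B" "A \<subseteq> B" "\<And>i. i \<in> B \<Longrightarrow> f i \<ge> 0"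
  shows "max_or_zero f A \<le> max_or_zero f B"
proof (cases "A = {}")
  case True
  \<comment> \<open>The default value 0 at the empty set is a lower bound only because some
    \<open>f b\<close> with \<open>b\<close> in \<open>B\<close> is nonnegative and lies below the
    maximum.\<close>
  have "0 \<le> Max (f ` B)" if "b \<in> B" for b
    using that assms by (meson Max_ge finite_imageI imageI order_trans)
  with True show ?thesis by (auto simp: max_or_zero_def)
next
  case False
  with assms show ?thesis by (auto simp: max_or_zero_def intro!: Max_mono)
qed

text \<open>Both summands grow separately: a larger set adds nonnegative terms to the modular sum
  and raises the maximum for every \<open>j\<close>, and scaling by \<open>l\<close> keeps the
  direction.\<close>

lemma mono_on_gain:
  assumes "finite V" "\<And>i. i \<in> V \<Longrightarrow> u i \<ge> 0"
    and "\<And>i j. i \<in> V \<Longrightarrow> j \<in> V \<Longrightarrow> s i j \<ge> 0" "l \<ge> 0"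
  shows "mono_on (Pow V) (gain V u s l)"
proof (rule mono_onI)
  fix A B assume "A \<in> Pow V" "B \<in> Pow V" "A \<subseteq> B"
  then have B: "finite B" "A \<subseteq> B" "B \<subseteq> V"
    using assms(1) finite_subset by auto
  have "(\<Sum>i\<in>A. u i) \<le> (\<Sum>i\<in>B. u i)"
    using B assms(2) by (intro sum_mono2) auto
  moreover have "(\<Sum>j\<in>V. max_or_zero (\<lambda>i. s i j) A) \<le> (\<Sum>j\<in>V. max_or_zero (\<lambda>i. s i j) B)"
    using B assms(3) by (intro sum_mono max_or_zero_mono) auto
  ultimately show "gain V u s l A \<le> gain V u s l B"
    using assms(4) by (simp add: gain_def add_mono mult_left_mono)
qed

lemma submodular_on_gain:
  assumes "finite V"
    and s: "\<And>i j. i \<in> V \<Longrightarrow> j \<in> V \<Longrightarrow> s i j \<ge> 0" and "l \<ge> 0"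
  shows "submodular_on V (gain V u s l)"
  unfolding submodular_on_def
proof (intro allI impI, elim conjE)
  fix A B e assume B: "A \<subseteq> B" "B \<subseteq> V" and e: "e \<in> V - B"
  let ?m = "\<lambda>S j. max_or_zero (\<lambda>i. s i j) S"
  have fin: "finite B" "finite A"
    using finite_subset[OF \<open>B \<subseteq> V\<close> \<open>finite V\<close>] finite_subset[OF \<open>A \<subseteq> B\<close>] by auto
  \<comment> \<open>Since \<open>e\<close> lies outside \<open>S\<close>, the modular part
    contributes exactly \<open>u e\<close>, the same for \<open>A\<close> and \<open>B\<close>. Only
    the sums over \<open>j\<close> remain to be compared.\<close>
  have marginal: "gain V u s l (S \<union> {e}) - gain V u s l S
      = u e + l * (\<Sum>j\<in>V. max (s e j) (?m S j) - ?m S j)" if "finite S" "e \<notin> S" for S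
  proof -
    have "(\<Sum>j\<in>V. ?m (insert e S) j) = (\<Sum>j\<in>V. max (s e j) (?m S j))"
      using that e s by (intro sum.cong max_or_zero_insert) auto
    with that show ?thesis
      by (simp add: gain_def sum_subtractf right_diff_distrib)
  qed
  have "(\<Sum>j\<in>V. max (s e j) (?m B j) - ?m B j) \<le> (\<Sum>j\<in>V. max (s e j) (?m A j) - ?m A j)"
  proof (rule sum_mono)
    fix j assume "j \<in> V"
    then have "?m A j \<le> ?m B j"
      using B fin s by (intro max_or_zero_mono) auto
    \<comment> \<open>For fixed \<open>c\<close>, the map taking \<open>x\<close> to
      \<open>max c x - x = max (c - x) 0\<close> is antitone, so the larger value at
      \<open>B\<close> leaves less to gain.\<close>
    then show "max (s e j) (?m B j) - ?m B j \<le> max (s e j) (?m A j) - ?m A j"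
      by (simp add: max_def)
  qed
  moreover have "e \<notin> A" "e \<notin> B"
    using B e by auto
  ultimately show "gain V u s l (B \<union> {e}) - gain V u s l B \<le> gain V u s l (A \<union> {e}) - gain V u s l A"
    unfolding marginal[OF fin(1) \<open>e \<notin> B\<close>] marginal[OF fin(2) \<open>e \<notin> A\<close>]
    using \<open>l \<ge> 0\<close> by (intro add_left_mono mult_left_mono)
qed

theorem proposition2:
  fixes N :: nat and V :: "nat set"
    and u :: "nat \<Rightarrow> real" and s :: "nat \<Rightarrow> nat \<Rightarrow> real" and l :: real
  assumes "V = {1..N}"
    and "\<And>i. i \<in> V \<Longrightarrow> u i \<ge> 0"
    and "\<And>i j. i \<in> V \<Longrightarrow> j \<in> V \<Longrightarrow> s i j \<ge> 0"
    and "l \<ge> 0"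
  shows "mono_on (Pow V) (gain V u s l) \<and> submodular_on V (gain V u s l)"
  using assms by (intro conjI mono_on_gain submodular_on_gain) auto

end
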